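(* Let $n\ge 2$ and let $P(x,y,z)=\sum_{\alpha\in\Delta_n}a_\alpha x^{\alpha_1}y^{\alpha_2}z^{\alpha_3}\in\mathbb{R}[x,y,z]$, where $\Delta_n=\{\alpha\in\mathbb{N}^3:\alpha_1+\alpha_2+\alpha_3=n\}$ and $a_\alpha>0$ for all $\alpha\in\Delta_n$. If every rhombus quotient of $P$ is greater than or equal to $2(n-1)$, then $P$ has the half-plane property.
   Context: A rhombus in $\Delta_n$ is a quadruple $(\alpha,\beta,\gamma,\delta)$ of points of $\Delta_n$ of the form $\alpha=\mu+e_k$, $\beta=\mu+e_i$, $\gamma=\mu+e_j$, $\delta=\mu+e_i+e_j-e_k$, where $\{i,j,k\}=\{1,2,3\}$, $\mu\in\mathbb{Z}^3$ with $\mu_1+\mu_2+\mu_3=n-1$, and $e_1,e_2,e_3$ are the standard unit vectors (so $\beta,\gamma$ are the endpoints of the short diagonal and $\alpha,\delta$ of the long diagonal of the rhombus formed by two adjacent unit triangles of the triangular grid $\Delta_n$). The rhombus quotients of $P$ are the numbers $a_\beta a_\gamma/(a_\alpha a_\delta)$ over all rhombi. A polynomial has the half-plane property if there is an open half-plane $H\subset\mathbb{C}$ whose boundary line passes through the origin such that the polynomial is nonzero whenever all variables lie in $H$. *)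

theory Defs
  imports "HOL-Analysis.Analysis"
begin

definition tri_grid :: "nat \<Rightarrow> (nat ^ 3) set" where
  "tri_grid n = {\<alpha>. \<alpha> $ 1 + \<alpha> $ 2 + \<alpha> $ 3 = n}"

lemma finite_tri_grid: "finite (tri_grid n)"
proof -
  have "tri_grid n \<subseteq> (\<lambda>(i, j, k). vector [i, j, k]) ` ({..n} \<times> {..n} \<times> {..n})"
  proof
    fix \<alpha> :: "nat ^ 3"
    assume \<alpha>: "\<alpha> \<in> tri_grid n"
    show "\<alpha> \<in> (\<lambda>(i, j, k). vector [i, j, k]) ` ({..n} \<times> {..n} \<times> {..n})"
    proof (rule image_eqI[where x = "(\<alpha> $ 1, \<alpha> $ 2, \<alpha> $ 3)"])
      show "\<alpha> = (\<lambda>(i, j, k). vector [i, j, k]) (\<alpha> $ 1, \<alpha> $ 2, \<alpha> $ 3)"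
        by (simp add: vec_eq_iff forall_3)
    qed (use \<alpha> in \<open>auto simp: tri_grid_def\<close>)
  qed
  then show ?thesis
    by (rule finite_subset) auto
qed

text \<open>
  The ternary form of degree \<open>n\<close> with real coefficient family \<open>a\<close>, as a function of
  complex variables; values of \<open>a\<close> outside \<open>tri_grid n\<close> are irrelevant.
\<close>

definition ternary_form :: "nat \<Rightarrow> (nat ^ 3 \<Rightarrow> real) \<Rightarrow> complex ^ 3 \<Rightarrow> complex" where
  "ternary_form n a v =
     (\<Sum>\<alpha>\<in>tri_grid n. of_real (a \<alpha>) * (v $ 1) ^ (\<alpha> $ 1) * (v $ 2) ^ (\<alpha> $ 2) * (v $ 3) ^ (\<alpha> $ 3))"

definition int_vec :: "nat ^ 'n \<Rightarrow> int ^ 'n" where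
  "int_vec \<alpha> = (\<chi> i. int (\<alpha> $ i))"

text \<open>
  In a rhombus \<open>(\<alpha>, \<beta>, \<gamma>, \<delta>)\<close>, \<open>\<beta>, \<gamma>\<close> are the ends of the short diagonal and \<open>\<alpha>, \<delta>\<close>
  those of the long one. The condition \<open>{i, j, k} = {1, 2, 3}\<close> makes the indices distinct.
\<close>

definition rhombi :: "nat \<Rightarrow> ((nat ^ 3) \<times> (nat ^ 3) \<times> (nat ^ 3) \<times> (nat ^ 3)) set" where
  "rhombi n = {(\<alpha>, \<beta>, \<gamma>, \<delta>).
     \<alpha> \<in> tri_grid n \<and> \<beta> \<in> tri_grid n \<and> \<gamma> \<in> tri_grid n \<and> \<delta> \<in> tri_grid n \<and>
     (\<exists>(\<mu> :: int ^ 3) i j k. {i, j, k} = {1, 2, 3} \<and>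
        \<mu> $ 1 + \<mu> $ 2 + \<mu> $ 3 = int n - 1 \<and>
        int_vec \<alpha> = \<mu> + axis k 1 \<and>
        int_vec \<beta> = \<mu> + axis i 1 \<and>
        int_vec \<gamma> = \<mu> + axis j 1 \<and>
        int_vec \<delta> = \<mu> + axis i 1 + axis j 1 - axis k 1)}"

definition rhombus_quotients :: "nat \<Rightarrow> (nat ^ 3 \<Rightarrow> real) \<Rightarrow> real set" where
  "rhombus_quotients n a =
     {a \<beta> * a \<gamma> / (a \<alpha> * a \<delta>) | \<alpha> \<beta> \<gamma> \<delta>. (\<alpha>, \<beta>, \<gamma>, \<delta>) \<in> rhombi n}"

text \<open>
  \<open>\<bullet>\<close> is the real inner product on \<open>complex\<close>, so \<open>{z. u \<bullet> z > 0}\<close> with \<open>u \<noteq> 0\<close> is the open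
  half-plane with inner normal \<open>u\<close> whose boundary line passes through the origin.
\<close>

definition half_plane_property :: "(complex ^ 'n \<Rightarrow> complex) \<Rightarrow> bool" where
  "half_plane_property p \<longleftrightarrow>
     (\<exists>H u. u \<noteq> 0 \<and> H = {z :: complex. u \<bullet> z > 0} \<and>
        (\<forall>v. (\<forall>i. v $ i \<in> H) \<longrightarrow> p v \<noteq> 0))"

end

theory Submission
  imports Defs "HOL-Computational_Algebra.Polynomial"
begin

text \<open>
  Write \<open>P = \<Sum>\<^sub>l R\<^sub>l(y, z) x\<^sup>l\<close>. For \<open>n \<ge> 3\<close> the rhombus inequalities with constant \<open>4\<close> already give
  \<open>R\<^sub>l\<^sup>2 > 4 R\<^sub>l\<^sub>-\<^sub>1 R\<^sub>l\<^sub>+\<^sub>1\<close> for all \<open>y, z \<ge> 0\<close> not both zero, so that, as in Hutchinson's theorem,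
  \<open>P(-\<xi>, y, z)\<close> has sign \<open>(-1)\<^sup>l\<close> whenever \<open>\<xi>\<^sup>2 R\<^sub>l\<^sub>+\<^sub>1 = R\<^sub>l\<^sub>-\<^sub>1\<close>; likewise for the other two variables.
  A real line \<open>t \<mapsto> u + t w\<close> with \<open>w > 0\<close> runs from the negative to the positive octant through two
  regions, in each of which one variable has the sign opposite to the other two, and the surfaces
  \<open>\<xi>\<^sup>2 R\<^sub>l\<^sub>+\<^sub>1 = R\<^sub>l\<^sub>-\<^sub>1\<close> of both regions fit together along their common face. By the intermediate
  value theorem the line meets all of them in order, so \<open>P\<close> changes sign \<open>n\<close> times along it.
  Hence \<open>P(u + t w)\<close> has \<open>n\<close> real roots in \<open>t\<close>, and \<open>|P(u + \<i> w)| \<ge> P(w) > 0\<close>, a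
  bound that survives limits in \<open>u\<close> and in the coefficients and so covers the degenerate lines and
  the case \<open>n = 2\<close>.
\<close>

section \<open>Hutchinson's sign criterion\<close>

text \<open>Leibniz estimate: a signed partial sum is its newest term minus the previous signed
  partial sum, which lies between 0 and the previous, no larger term.\<close>

lemma alternating_sum_increasing:
  fixes T :: "nat \<Rightarrow> real"
  assumes "\<And>k. k \<le> N \<Longrightarrow> 0 \<le> T k" and "\<And>k. k < N \<Longrightarrow> T k \<le> T (Suc k)"
  shows "0 \<le> (-1) ^ N * (\<Sum>k\<le>N. (-1) ^ k * T k) \<and> (-1) ^ N * (\<Sum>k\<le>N. (-1) ^ k * T k) \<le> T N"
  using assms
proof (induction N)
  case (Suc N)
  have IH: "0 \<le> (-1) ^ N * (\<Sum>k\<le>N. (-1) ^ k * T k)" "(-1) ^ N * (\<Sum>k\<le>N. (-1) ^ k * T k) \<le> T N"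
    using Suc by auto
  have "(-1) ^ Suc N * (\<Sum>k\<le>Suc N. (-1) ^ k * T k) = T (Suc N) - (-1) ^ N * (\<Sum>k\<le>N. (-1) ^ k * T k)"
    by (simp add: algebra_simps flip: power_add mult_2)
  with IH Suc.prems(2)[of N] show ?case
    by simp
qed simp

lemma alternating_sum_decreasing:
  fixes T :: "nat \<Rightarrow> real"
  assumes "m \<le> N" and "\<And>k. m \<le> k \<Longrightarrow> k \<le> N \<Longrightarrow> 0 \<le> T k"
    and "\<And>k. m \<le> k \<Longrightarrow> k < N \<Longrightarrow> T (Suc k) \<le> T k"
  shows "0 \<le> (-1) ^ m * (\<Sum>k=m..N. (-1) ^ k * T k) \<and> (-1) ^ m * (\<Sum>k=m..N. (-1) ^ k * T k) \<le> T m"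
  using assms
proof (induction m rule: inc_induct)
  case (step m)
  have IH: "0 \<le> (-1) ^ Suc m * (\<Sum>k=Suc m..N. (-1) ^ k * T k)"
    "(-1) ^ Suc m * (\<Sum>k=Suc m..N. (-1) ^ k * T k) \<le> T (Suc m)"
    using step by auto
  have "(\<Sum>k=m..N. (-1) ^ k * T k) = (-1) ^ m * T m + (\<Sum>k=Suc m..N. (-1) ^ k * T k)"
    using step.hyps by (simp add: sum.atLeast_Suc_atMost)
  then have "(-1) ^ m * (\<Sum>k=m..N. (-1) ^ k * T k) = T m - (-1) ^ Suc m * (\<Sum>k=Suc m..N. (-1) ^ k * T k)"
    by (simp add: algebra_simps flip: power_add mult_2)
  with IH step.prems(2)[of m] step.hyps show ?case
    by simp
qed (simp flip: power_add mult_2)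

text \<open>An increase propagates to the left in a log-concave sequence; for the reversed sequence,
  a decrease propagates to the right.\<close>

lemma log_concave_ratio_step:
  fixes p q r :: real
  assumes "0 < p" "0 < q" "0 < r" "p * r \<le> q\<^sup>2" "q \<le> r"
  shows "p \<le> q"
proof -
  have "p * q \<le> p * r" using assms by simp
  also have "\<dots> \<le> q * q" using assms by (simp add: power2_eq_square)
  finally show ?thesis using assms by simp
qed

text \<open>The factor 4 and \<open>T (l - 1) = T (l + 1)\<close> force
  \<open>T l > 2 * T (l - 1)\<close>, and log-concavity makes \<open>T\<close> rise up to
  \<open>l\<close> and fall after it. The alternating tails on the two sides are at most
  \<open>T (l - 1)\<close> and \<open>T (l + 1)\<close>, so the peak outweighs both and fixes the
  sign.\<close>

lemma Hutchinson_sign: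
  fixes T :: "nat \<Rightarrow> real"
  assumes pos: "\<And>k. k \<le> n \<Longrightarrow> 0 < T k"
    and lc: "\<And>k. 1 \<le> k \<Longrightarrow> k < n \<Longrightarrow> 4 * (T (k - 1) * T (k + 1)) < (T k)\<^sup>2"
    and l: "1 \<le> l" "l < n" and eq: "T (l - 1) = T (l + 1)"
  shows "0 < (-1) ^ l * (\<Sum>k\<le>n. (-1) ^ k * T k)"
proof -
  have lc': "T (k - 1) * T (k + 1) \<le> (T k)\<^sup>2" if "1 \<le> k" "k < n" for k
    using lc[OF that] mult_pos_pos[OF pos pos, of "k - 1" "k + 1"] that by force
  have "(2 * T (l - 1))\<^sup>2 < (T l)\<^sup>2"
    using lc[OF l] eq by (simp add: power2_eq_square)
  then have peak: "2 * T (l - 1) < T l"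
    using pos[of l] l by (intro power2_less_imp_less[of "2 * T (l - 1)" "T l"]) auto
  have first: "0 < T (l - 1)" using pos l by simp
  have left: "T k \<le> T (Suc k)" if "k \<le> l - 1" for k
    using that
  proof (induction k rule: inc_induct)
    case base
    then show ?case using peak first l by simp
  next
    case (step k)
    show ?case
      by (rule log_concave_ratio_step[where r = "T (Suc (Suc k))"])
        (use step pos lc'[of "Suc k"] l in auto)
  qed
  have right: "T (Suc k) \<le> T k" if "l \<le> k" "k < n" for k
    using that
  proof (induction k rule: dec_induct)
    case base
    then show ?case using peak first l eq by simp
  next
    case (step k)
    show ?case
      by (rule log_concave_ratio_step[where r = "T k"])
        (use step pos lc'[of "Suc k"] l in \<open>auto simp: mult.commute\<close>)
  qed
  obtain l' where l': "l = Suc l'" using l by (cases l) auto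
  have split: "(\<Sum>k\<le>n. (-1) ^ k * T k) = (\<Sum>k\<le>l. (-1) ^ k * T k) + (\<Sum>k=Suc l..n. (-1) ^ k * T k)"
    using l sum_up_index_split[of "\<lambda>k. (-1) ^ k * T k" l "n - l"] by simp
  have "(-1) ^ l * (\<Sum>k\<le>n. (-1) ^ k * T k) = T l - (-1) ^ l' * (\<Sum>k\<le>l'. (-1) ^ k * T k)
      - (-1) ^ Suc l * (\<Sum>k=Suc l..n. (-1) ^ k * T k)"
    unfolding split unfolding l' by (simp add: algebra_simps flip: power_add mult_2)
  moreover have "(-1) ^ l' * (\<Sum>k\<le>l'. (-1) ^ k * T k) \<le> T l'"
    using alternating_sum_increasing[of l' T] left pos l l' by (simp add: less_imp_le)
  moreover have "(-1) ^ Suc l * (\<Sum>k=Suc l..n. (-1) ^ k * T k) \<le> T (Suc l)"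
    using alternating_sum_decreasing[of "Suc l" n T] right pos l by (simp add: less_imp_le)
  ultimately show ?thesis
    using peak eq l' by simp
qed

section \<open>Consecutive rows of a rhombic array\<close>

text \<open>The square contains each neighbouring product twice and each square once; its other
  products are nonnegative. The squares are kept because they later provide strictness.\<close>

lemma sum_neighbours_le_square:
  fixes C :: "nat \<Rightarrow> real"
  assumes "\<And>j. j \<le> m \<Longrightarrow> 0 \<le> C j"
  shows "2 * (\<Sum>j<m. C j * C (Suc j)) + (\<Sum>j\<le>m. (C j)\<^sup>2) \<le> (\<Sum>j\<le>m. C j)\<^sup>2"
  using assms
proof (induction m)
  case (Suc m)
  have "C m \<le> (\<Sum>j\<le>m. C j)"
    by (rule member_le_sum) (use Suc.prems in auto)
  then have "C m * C (Suc m) \<le> (\<Sum>j\<le>m. C j) * C (Suc m)"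
    by (rule mult_right_mono) (use Suc.prems in auto)
  with Suc show ?case
    by (simp add: power2_eq_square algebra_simps)
qed (simp add: power2_eq_square)

text \<open>
  Here \<open>c\<close>, \<open>d\<close>, \<open>e\<close> are three consecutive rows of the triangular array of coefficients, the row
  \<open>d\<close> having one entry more and the row \<open>e\<close> one entry less than \<open>c\<close>.
\<close>

locale rhombus_rows =
  fixes m :: nat and q :: real and c d e :: "nat \<Rightarrow> real"
  assumes m: "1 \<le> m" and q: "1 \<le> q"
    and c: "\<And>j. j \<le> m \<Longrightarrow> 0 < c j"
    and d: "\<And>j. j \<le> Suc m \<Longrightarrow> 0 < d j"
    and e: "\<And>j. j < m \<Longrightarrow> 0 < e j"
    and middle: "\<And>j. j < m \<Longrightarrow> q * (d (Suc j) * e j) \<le> c j * c (Suc j)"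
    and left: "\<And>j. j < m \<Longrightarrow> q * (d j * c (Suc j)) \<le> c j * d (Suc j)"
    and right: "\<And>j. j < m \<Longrightarrow> q * (d (Suc (Suc j)) * c j) \<le> c (Suc j) * d (Suc j)"
begin

text \<open>For \<open>i = j\<close>, one \<open>left\<close> and one \<open>middle\<close>
  inequality give the factor \<open>q\<^sup>2\<close>. Each further column uses another
  \<open>left\<close> inequality, whose extra factor \<open>q \<ge> 1\<close> is discarded.\<close>

lemma below: "q\<^sup>2 * (d i * e j) \<le> c i * c j" if "i \<le> j" "j < m" for i j
  using that
proof (induction i rule: inc_induct)
  case base
  have "q\<^sup>2 * (d j * e j) * c (Suc j) = q * (d j * c (Suc j)) * (q * e j)"
    by (simp add: power2_eq_square)
  also have "\<dots> \<le> c j * d (Suc j) * (q * e j)"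
    using left[of j] e[of j] q base by (intro mult_right_mono) auto
  also have "\<dots> = c j * (q * (d (Suc j) * e j))" by simp
  also have "\<dots> \<le> c j * (c j * c (Suc j))"
    using middle[of j] c[of j] base by (intro mult_left_mono) auto
  finally show ?case using c[of "Suc j"] base by (simp add: mult.assoc)
next
  case (step i)
  have "q\<^sup>2 * (d i * e j) * c (Suc i) \<le> q * (q\<^sup>2 * (d i * e j) * c (Suc i))"
    using q d[of i] e[of j] c[of "Suc i"] step by simp
  also have "\<dots> = q * (d i * c (Suc i)) * (q\<^sup>2 * e j)" by simp
  also have "\<dots> \<le> c i * d (Suc i) * (q\<^sup>2 * e j)"
    using left[of i] e[of j] q step by (intro mult_right_mono) auto
  also have "\<dots> = c i * (q\<^sup>2 * (d (Suc i) * e j))" by simp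
  also have "\<dots> \<le> c i * (c (Suc i) * c j)"
    using step c[of i] by (intro mult_left_mono) auto
  finally show ?case using c[of "Suc i"] step by (simp add: mult.assoc)
qed

lemma above: "q\<^sup>2 * (d (Suc i) * e j) \<le> c i * c (Suc j)" if "Suc j \<le> i" "i \<le> m" for i j
  using that
proof (induction i rule: dec_induct)
  case base
  have "q\<^sup>2 * (d (Suc (Suc j)) * e j) * c j = q * (d (Suc (Suc j)) * c j) * (q * e j)"
    by (simp add: power2_eq_square)
  also have "\<dots> \<le> c (Suc j) * d (Suc j) * (q * e j)"
    using right[of j] e[of j] q base by (intro mult_right_mono) auto
  also have "\<dots> = c (Suc j) * (q * (d (Suc j) * e j))" by simp
  also have "\<dots> \<le> c (Suc j) * (c j * c (Suc j))"
    using middle[of j] c[of "Suc j"] base by (intro mult_left_mono) auto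
  finally show ?case using c[of j] base by (simp add: mult.assoc)
next
  case (step i)
  have "q\<^sup>2 * (d (Suc (Suc i)) * e j) * c i \<le> q * (q\<^sup>2 * (d (Suc (Suc i)) * e j) * c i)"
    using q d[of "Suc (Suc i)"] e[of j] c[of i] step by simp
  also have "\<dots> = q * (d (Suc (Suc i)) * c i) * (q\<^sup>2 * e j)" by simp
  also have "\<dots> \<le> c (Suc i) * d (Suc i) * (q\<^sup>2 * e j)"
    using right[of i] e[of j] q step by (intro mult_right_mono) auto
  also have "\<dots> = c (Suc i) * (q\<^sup>2 * (d (Suc i) * e j))" by simp
  also have "\<dots> \<le> c (Suc i) * (c i * c (Suc j))"
    using step c[of "Suc i"] by (intro mult_left_mono) auto
  finally show ?case using c[of i] step by (simp add: mult.assoc)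
qed

text \<open>Each product of a \<open>d\<close>-term and an \<open>e\<close>-term is charged to a
  product of two \<open>c\<close>-terms with the same monomial. If \<open>q \<ge> 4\<close>, the
  pairs covered by \<open>middle\<close> cost at most the sum of neighbouring products, which is
  less than half of the square by \<open>sum_neighbours_le_square\<close>; all other pairs, using
  \<open>q\<^sup>2 \<ge> 16\<close>, cost at most two quarters of it.\<close>

lemma rows_log_concave:
  fixes y z :: real
  assumes y: "0 \<le> y" and z: "0 \<le> z" and yz: "0 < y \<or> 0 < z"
    and large: "4 \<le> q \<or> m = 1 \<and> 2 < q"
  shows "4 * ((\<Sum>i\<le>Suc m. d i * y ^ i * z ^ (Suc m - i)) * (\<Sum>j\<le>m-1. e j * y ^ j * z ^ (m - 1 - j)))
    < (\<Sum>j\<le>m. c j * y ^ j * z ^ (m - j))\<^sup>2"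
proof -
  define C where "C j = c j * y ^ j * z ^ (m - j)" for j
  define D where "D i = d i * y ^ i * z ^ (Suc m - i)" for i
  define E where "E j = e j * y ^ j * z ^ (m - 1 - j)" for j
  define S where "S = (\<Sum>j\<le>m. C j)"
  have C0: "0 \<le> C j" if "j \<le> m" for j
    using c[OF that] y z by (simp add: C_def)
  \<comment> \<open>Both kinds of product carry a monomial depending only on \<open>i + j\<close>,
    so \<open>middle\<close>, \<open>below\<close> and \<open>above\<close> carry over from
    coefficients to terms.\<close>
  have DE: "D i * E j = d i * e j * (y ^ (i + j) * z ^ (2 * m - i - j))" if "i \<le> Suc m" "j < m" for i j
  proof -
    have "2 * m - i - j = (Suc m - i) + (m - 1 - j)" using that by auto
    then show ?thesis by (simp add: D_def E_def power_add)
  qed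
  have CC: "C i * C j = c i * c j * (y ^ (i + j) * z ^ (2 * m - i - j))" if "i \<le> m" "j \<le> m" for i j
  proof -
    have "2 * m - i - j = (m - i) + (m - j)" using that by auto
    then show ?thesis by (simp add: C_def power_add)
  qed
  have yz0: "0 \<le> y ^ i * z ^ j" for i j using y z by simp
  have mid: "q * (D (Suc j) * E j) \<le> C j * C (Suc j)" if "j < m" for j
    using mult_right_mono[OF middle[OF that] yz0, of "j + Suc j" "2 * m - j - Suc j"] that
    by (simp add: DE CC)
  have bel: "q\<^sup>2 * (D i * E j) \<le> C i * C j" if "i \<le> j" "j < m" for i j
    using mult_right_mono[OF below[OF that] yz0, of "i + j" "2 * m - i - j"] that
    by (simp add: DE CC)
  have abv: "q\<^sup>2 * (D (Suc i) * E j) \<le> C i * C (Suc j)" if "Suc j \<le> i" "i \<le> m" for i j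
    using mult_right_mono[OF above[OF that] yz0, of "i + Suc j" "2 * m - i - Suc j"] that
    by (simp add: DE CC)
  have DE0: "0 \<le> D i * E j" if "i \<le> Suc m" "j < m" for i j
    using that d[of i] e[of j] yz0 by (simp add: DE)
  have end_pos: "0 < C 0 \<or> 0 < C m"
    using yz c[of 0] c[of m] by (auto simp: C_def)
  have sq_pos: "0 < (\<Sum>j\<le>m. (C j)\<^sup>2)"
    using end_pos
  proof
    assume "0 < C 0"
    then show ?thesis by (intro sum_pos2[where i = 0]) auto
  next
    assume "0 < C m"
    then show ?thesis by (intro sum_pos2[where i = m]) auto
  qed
  have "4 * ((\<Sum>i\<le>Suc m. D i) * (\<Sum>j\<le>m-1. E j)) < S\<^sup>2"
    using large
  proof
    assume q4: "4 \<le> q"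
    have q16: "16 \<le> q\<^sup>2" using power_mono[OF q4, of 2] by simp
    have col: "(\<Sum>i\<le>Suc m. 4 * (D i * E j)) \<le> C j * S / 4 + C j * C (Suc j) + C (Suc j) * S / 4"
      if j: "j < m" for j
    proof -
      have "4 * (D i * E j) \<le> C i * C j / 4" if "i \<le> j" for i
        using bel[of i j] mult_right_mono[OF q16 DE0[of i j]] that j by simp
      then have "(\<Sum>i\<le>j. 4 * (D i * E j)) \<le> (\<Sum>i\<le>j. C i * C j / 4)"
        by (intro sum_mono) auto
      also have "\<dots> = C j * (\<Sum>i\<le>j. C i) / 4"
        by (simp add: sum_distrib_left sum_divide_distrib mult.commute)
      also have "\<dots> \<le> C j * S / 4"
        using C0 j unfolding S_def by (intro divide_right_mono mult_left_mono sum_mono2) auto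
      finally have 1: "(\<Sum>i\<le>j. 4 * (D i * E j)) \<le> C j * S / 4" .
      have 2: "4 * (D (Suc j) * E j) \<le> C j * C (Suc j)"
        using mid[OF j] mult_right_mono[OF q4 DE0[of "Suc j" j]] j by simp
      have "4 * (D (Suc i) * E j) \<le> C i * C (Suc j) / 4" if "Suc j \<le> i" "i \<le> m" for i
        using abv[OF that] mult_right_mono[OF q16 DE0[of "Suc i" j]] that j by simp
      then have "(\<Sum>i=Suc j..m. 4 * (D (Suc i) * E j)) \<le> (\<Sum>i=Suc j..m. C i * C (Suc j) / 4)"
        by (intro sum_mono) auto
      also have "\<dots> = C (Suc j) * (\<Sum>i=Suc j..m. C i) / 4"
        by (simp add: sum_distrib_left sum_divide_distrib mult.commute)
      also have "\<dots> \<le> C (Suc j) * S / 4"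
        using C0 j unfolding S_def by (intro divide_right_mono mult_left_mono sum_mono2) auto
      finally have 3: "(\<Sum>i=Suc (Suc j)..Suc m. 4 * (D i * E j)) \<le> C (Suc j) * S / 4"
        unfolding sum.shift_bounds_cl_Suc_ivl .
      have "(\<Sum>i\<le>Suc m. 4 * (D i * E j)) = (\<Sum>i\<le>Suc j. 4 * (D i * E j)) + (\<Sum>i=Suc (Suc j)..Suc m. 4 * (D i * E j))"
        using j sum_up_index_split[of "\<lambda>i. 4 * (D i * E j)" "Suc j" "m - j"] by simp
      with 1 2 3 show ?thesis by simp
    qed
    have "4 * ((\<Sum>i\<le>Suc m. D i) * (\<Sum>j\<le>m-1. E j)) = (\<Sum>j<m. \<Sum>i\<le>Suc m. 4 * (D i * E j))"
    proof -
      have "{..m-1} = {..<m}" using m by auto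
      then show ?thesis
        by (simp flip: sum_distrib_left sum_distrib_right)
    qed
    also have "\<dots> \<le> (\<Sum>j<m. C j * S / 4 + C j * C (Suc j) + C (Suc j) * S / 4)"
      by (intro sum_mono col) auto
    also have "\<dots> = (\<Sum>j<m. C j) * S / 4 + (\<Sum>j<m. C j * C (Suc j)) + (\<Sum>j<m. C (Suc j)) * S / 4"
      by (simp add: sum.distrib sum_distrib_right sum_divide_distrib)
    also have "\<dots> \<le> S * S / 4 + (\<Sum>j<m. C j * C (Suc j)) + S * S / 4"
    proof -
      have "(\<Sum>j<m. C j) \<le> S"
        unfolding S_def using C0 by (intro sum_mono2) auto
      moreover have "(\<Sum>j<m. C (Suc j)) = (\<Sum>j\<in>Suc ` {..<m}. C j)"
        by (simp add: sum.reindex)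
      moreover have "(\<Sum>j\<in>Suc ` {..<m}. C j) \<le> S"
        unfolding S_def using C0 by (intro sum_mono2) auto
      moreover have "0 \<le> S"
        unfolding S_def using C0 by (intro sum_nonneg) auto
      ultimately show ?thesis
        by (intro add_mono divide_right_mono mult_right_mono) auto
    qed
    also have "\<dots> < S\<^sup>2"
      using sum_neighbours_le_square[of m C] C0 sq_pos unfolding S_def
      by (simp add: power2_eq_square)
    finally show ?thesis .
  next
    assume m1: "m = 1 \<and> 2 < q"
    have b: "2 * (D 1 * E 0) \<le> C 0 * C 1"
      using mid[of 0] mult_right_mono[OF less_imp_le DE0[of 1 0], of 2 q] m1 by simp
    \<comment> \<open>For \<open>m = 1\<close> the bound \<open>b\<close> uses up exactly the cross
      term of the square, so strictness must come from the two outer products, through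
      \<open>q\<^sup>2 > 4\<close>.\<close>
    have strict: "4 * (D 0 * E 0) + 4 * (D 2 * E 0) < C 0 * C 0 + C 1 * C 1"
    proof -
      have "4 < q\<^sup>2" using power_strict_mono[of 2 q 2] m1 by simp
      have "0 < D 0 * E 0 + D 2 * E 0"
        using yz y z d[of 0] d[of 2] e[of 0] m1
        by (auto simp: D_def E_def intro: add_pos_nonneg add_nonneg_pos)
      then have "4 * (D 0 * E 0 + D 2 * E 0) < q\<^sup>2 * (D 0 * E 0 + D 2 * E 0)"
        using \<open>4 < q\<^sup>2\<close> by (rule mult_strict_right_mono[rotated])
      also have "\<dots> \<le> C 0 * C 0 + C 1 * C 1"
        using bel[of 0 0] abv[of 0 1] m1 by (simp add: numeral_2_eq_2 algebra_simps)
      finally show ?thesis by simp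
    qed
    have "4 * ((\<Sum>i\<le>Suc m. D i) * (\<Sum>j\<le>m-1. E j)) = 4 * (D 0 * E 0) + 4 * (D 2 * E 0) + 4 * (D 1 * E 0)"
      using m1 by (simp add: numeral_2_eq_2 algebra_simps)
    moreover have "S\<^sup>2 = C 0 * C 0 + C 1 * C 1 + 2 * (C 0 * C 1)"
      using m1 by (simp add: S_def power2_eq_square algebra_simps)
    ultimately show ?thesis
      using strict b by linarith
  qed
  then show ?thesis
    unfolding S_def C_def D_def E_def .
qed

end

section \<open>Ternary forms and their slices\<close>

definition triples :: "nat \<Rightarrow> (nat \<times> nat \<times> nat) set" where
  "triples n = {(i, j, k). i + j + k = n}"

text \<open>Polymorphic in the field: signs are studied over the reals, and the same form is then
  evaluated at complex points.\<close>

definition form3 :: "nat \<Rightarrow> (nat \<Rightarrow> nat \<Rightarrow> nat \<Rightarrow> real) \<Rightarrow> 'a \<Rightarrow> 'a \<Rightarrow> 'a \<Rightarrow> 'a :: real_field" where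
  "form3 n b x y z = (\<Sum>(i, j, k)\<in>triples n. of_real (b i j k) * x ^ i * y ^ j * z ^ k)"

definition slice :: "nat \<Rightarrow> (nat \<Rightarrow> nat \<Rightarrow> nat \<Rightarrow> real) \<Rightarrow> nat \<Rightarrow> real \<Rightarrow> real \<Rightarrow> real" where
  "slice n b l y z = (\<Sum>j\<le>n-l. b l j (n - l - j) * y ^ j * z ^ (n - l - j))"

lemma finite_triples [simp]: "finite (triples n)"
proof (rule finite_subset)
  show "triples n \<subseteq> {..n} \<times> {..n} \<times> {..n}"
    by (auto simp: triples_def)
qed simp

lemma form3_rotate: "form3 n (\<lambda>i j k. b j k i) z x y = form3 n b x y z"
  unfolding form3_def
  by (rule sum.reindex_bij_witness[where i = "\<lambda>(i, j, k). (k, i, j)" and j = "\<lambda>(i, j, k). (j, k, i)"])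
    (auto simp: triples_def)

lemma form3_swap: "form3 n (\<lambda>i j k. b i k j) x z y = form3 n b x y z"
  unfolding form3_def
  by (rule sum.reindex_bij_witness[where i = "\<lambda>(i, j, k). (i, k, j)" and j = "\<lambda>(i, j, k). (i, k, j)"])
    (auto simp: triples_def)

lemma form3_slices:
  fixes x y z :: real
  shows "form3 n b x y z = (\<Sum>l\<le>n. slice n b l y z * x ^ l)"
proof -
  have "(\<Sum>l\<le>n. slice n b l y z * x ^ l)
      = (\<Sum>(l, j)\<in>(SIGMA l:{..n}. {..n-l}). b l j (n - l - j) * x ^ l * y ^ j * z ^ (n - l - j))"
    by (subst sum.Sigma[symmetric]) (auto simp: slice_def sum_distrib_left sum_distrib_right mult_ac)
  also have "\<dots> = form3 n b x y z"
    unfolding form3_def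
    by (rule sum.reindex_bij_witness[where i = "\<lambda>(i, j, k). (i, j)" and j = "\<lambda>(i, j). (i, j, n - i - j)"])
      (auto simp: triples_def)
  finally show ?thesis by simp
qed

lemma form3_minus: "form3 n b (-x) (-y) (-z) = (-1) ^ n * form3 n b x y z"
proof -
  have "(-x) ^ i * ((-y) ^ j * (-z) ^ k) = (-1) ^ n * (x ^ i * (y ^ j * z ^ k))" if "i + j + k = n" for i j k
    using that by (auto simp: power_minus[of x] power_minus[of y] power_minus[of z] power_add)
  then show ?thesis
    unfolding form3_def sum_distrib_left
    by (intro sum.cong refl) (auto simp: triples_def mult.assoc mult.left_commute[of _ "of_real _"])
qed

lemma form3_of_real: "form3 n b (of_real x) (of_real y) (of_real z) = of_real (form3 n b x y z)"
  by (simp add: form3_def case_prod_unfold)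

definition coeffs_pos :: "nat \<Rightarrow> (nat \<Rightarrow> nat \<Rightarrow> nat \<Rightarrow> real) \<Rightarrow> bool" where
  "coeffs_pos n b \<longleftrightarrow> (\<forall>i j k. i + j + k = n \<longrightarrow> 0 < b i j k)"

lemma slice_pos:
  assumes "coeffs_pos n b" "l \<le> n" "0 \<le> y" "0 \<le> z" "0 < y \<or> 0 < z"
  shows "0 < slice n b l y z"
proof -
  have b: "0 < b l j (n - l - j)" if "j \<le> n - l" for j
    using assms that by (simp add: coeffs_pos_def)
  have nn: "0 \<le> b l j (n - l - j) * y ^ j * z ^ (n - l - j)" if "j \<le> n - l" for j
    using b[OF that] assms by simp
  show ?thesis
    using assms(5)
  proof
    assume "0 < y"
    then show ?thesis unfolding slice_def
      using nn b[of "n - l"] by (intro sum_pos2[where i = "n - l"]) auto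
  next
    assume "0 < z"
    then show ?thesis unfolding slice_def
      using nn b[of 0] by (intro sum_pos2[where i = 0]) auto
  qed
qed

lemma slice_zero_right: "l \<le> n \<Longrightarrow> slice n b l y 0 = b l (n - l) 0 * y ^ (n - l)"
  unfolding slice_def
  by (subst sum.mono_neutral_right[of _ "{n - l}"]) (auto simp: power_0_left)

lemma slice_zero_left: "l \<le> n \<Longrightarrow> slice n b l 0 z = b l 0 (n - l) * z ^ (n - l)"
  unfolding slice_def
  by (subst sum.mono_neutral_right[of _ "{0}"]) (auto simp: power_0_left)

lemma form3_pos:
  fixes x y z :: real
  assumes "coeffs_pos n b" "0 \<le> x" "0 \<le> y" "0 \<le> z" "0 < y \<or> 0 < z"
  shows "0 < form3 n b x y z"
  unfolding form3_slices
  by (rule sum_pos2[where i = 0])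
    (use assms slice_pos[OF assms(1) _ assms(3-5)] in \<open>auto simp: less_imp_le\<close>)

text \<open>The edges of the quadrant are included because a variable vanishes where the two regions
  of a line meet.\<close>

definition slices_log_concave :: "nat \<Rightarrow> (nat \<Rightarrow> nat \<Rightarrow> nat \<Rightarrow> real) \<Rightarrow> bool" where
  "slices_log_concave n b \<longleftrightarrow> (\<forall>l y z. 1 \<le> l \<and> l < n \<and> 0 \<le> y \<and> 0 \<le> z \<and> (0 < y \<or> 0 < z) \<longrightarrow>
     4 * (slice n b (l - 1) y z * slice n b (l + 1) y z) < (slice n b l y z)\<^sup>2)"

text \<open>\<open>Hutchinson_sign\<close> for \<open>T k = slice n b k y z * x ^ k\<close>: the
  powers of \<open>x\<close> cancel in the log-concavity condition, and \<open>eq\<close> says that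
  the terms next to \<open>l\<close> balance.\<close>

lemma form3_sign:
  fixes x y z :: real
  assumes b: "coeffs_pos n b" "slices_log_concave n b"
    and l: "1 \<le> l" "l < n" and x: "0 < x" and yz: "0 \<le> y" "0 \<le> z" "0 < y \<or> 0 < z"
    and eq: "x\<^sup>2 * slice n b (l + 1) y z = slice n b (l - 1) y z"
  shows "0 < (-1) ^ l * form3 n b (-x) y z"
proof -
  define T where "T k = slice n b k y z * x ^ k" for k
  have "0 < (-1) ^ l * (\<Sum>k\<le>n. (-1) ^ k * T k)"
  proof (rule Hutchinson_sign)
    show "0 < T k" if "k \<le> n" for k
      using slice_pos[OF b(1) that yz] x by (simp add: T_def)
    show "4 * (T (k - 1) * T (k + 1)) < (T k)\<^sup>2" if k: "1 \<le> k" "k < n" for k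
    proof -
      have "4 * (slice n b (k - 1) y z * slice n b (k + 1) y z) < (slice n b k y z)\<^sup>2"
        using b(2) k yz by (auto simp: slices_log_concave_def)
      then have "4 * (slice n b (k - 1) y z * slice n b (k + 1) y z) * (x ^ k)\<^sup>2 < (slice n b k y z)\<^sup>2 * (x ^ k)\<^sup>2"
        using x by simp
      moreover have "(x ^ k)\<^sup>2 = x ^ (k - 1) * x ^ (k + 1)"
        using k by (cases k) (simp_all add: power2_eq_square)
      ultimately show ?thesis
        unfolding T_def by (simp add: algebra_simps)
    qed
    have "x ^ (l + 1) = x\<^sup>2 * x ^ (l - 1)"
      using l by (simp flip: power_add)
    then show "T (l - 1) = T (l + 1)"
      using eq unfolding T_def by (metis (no_types) mult.assoc mult.commute)
  qed (use l in auto)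
  then show ?thesis
    by (simp add: form3_slices T_def power_minus[of x] mult_ac)
qed

text \<open>Multiply two consecutive inequalities and cancel. The ratio of slice
  \<open>l - 1\<close> to slice \<open>l + 1\<close> thus strictly increases with \<open>l\<close>,
  so the surfaces on which \<open>form3_sign\<close> applies are nested.\<close>

lemma slices_log_concave_step:
  assumes b: "coeffs_pos n b" "slices_log_concave n b"
    and l: "1 \<le> l" "l + 1 < n" and yz: "0 \<le> y" "0 \<le> z" "0 < y \<or> 0 < z"
  shows "slice n b (l - 1) y z * slice n b (l + 2) y z < slice n b l y z * slice n b (l + 1) y z"
proof -
  define p q r s where "p = slice n b (l - 1) y z" and "q = slice n b l y z"
    and "r = slice n b (l + 1) y z" and "s = slice n b (l + 2) y z"
  have pos: "0 < p" "0 < q" "0 < r" "0 < s"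
    unfolding p_def q_def r_def s_def using l by (auto intro!: slice_pos[OF b(1) _ yz])
  have "4 * (p * r) < q\<^sup>2" "4 * (q * s) < r\<^sup>2"
    using b(2)[unfolded slices_log_concave_def, rule_format, of l y z]
      b(2)[unfolded slices_log_concave_def, rule_format, of "l + 1" y z] l yz
    by (auto simp: p_def q_def r_def s_def)
  then have "p * r < q\<^sup>2" "q * s < r\<^sup>2"
    using mult_pos_pos[OF pos(1,3)] mult_pos_pos[OF pos(2,4)] by linarith+
  then have "(p * r) * (q * s) < q\<^sup>2 * r\<^sup>2"
    using pos by (intro mult_strict_mono) auto
  then have "(p * s) * (q * r) < (q * r) * (q * r)"
    by (simp add: power2_eq_square mult_ac)
  then have "p * s < q * r"
    using pos by (simp only: mult_less_cancel_right_pos mult_pos_pos)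
  then show ?thesis unfolding p_def q_def r_def s_def .
qed

section \<open>Sign changes along a line\<close>

text \<open>\<open>s\<close> is the maximum of the compact set where \<open>G \<ge> c\<close>. Since
  \<open>G\<close> need not be monotone, choosing the last crossing is what later makes the
  crossings of different functions comparable.\<close>

lemma last_crossing:
  fixes G :: "real \<Rightarrow> real"
  assumes "a < b" and cont: "continuous_on {a..b} G" and "c < G a" "G b < c"
  obtains s where "a < s" "s < b" "G s = c" "\<And>t. s < t \<Longrightarrow> t \<le> b \<Longrightarrow> G t < c"
proof -
  define Z where "Z = {a..b} \<inter> G -` {c..}"
  have "compact Z"
    unfolding Z_def compact_eq_bounded_closed
    using continuous_closed_preimage[OF cont, of "{c..}"] by (simp add: bounded_Int)
  moreover have "a \<in> Z" using assms by (auto simp: Z_def)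
  ultimately obtain s where s: "s \<in> Z" "\<And>t. t \<in> Z \<Longrightarrow> t \<le> s"
    using compact_attains_sup[of Z] by blast
  have after: "G t < c" if "s < t" "t \<le> b" for t
    using s(1) s(2)[of t] that by (force simp: Z_def)
  have sb: "s < b" using s(1) assms(4) by (cases "s = b") (auto simp: Z_def)
  have "G s = c"
  proof (rule ccontr)
    assume "G s \<noteq> c"
    then have "c < G s" using s(1) by (auto simp: Z_def)
    moreover have "continuous_on {s..b} G"
      using cont s(1) by (auto simp: Z_def intro: continuous_on_subset)
    ultimately obtain t where "s \<le> t" "t \<le> b" "G t = c"
      using IVT2'[of G b c s] sb assms(4) by auto
    with \<open>c < G s\<close> after[of t] show False by (cases "s = t") auto
  qed
  moreover have "a < s"
    using s(1) \<open>G s = c\<close> assms(3) by (cases "s = a") (auto simp: Z_def)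
  ultimately show thesis using that sb after by blast
qed

text \<open>\<open>N / (N + D)\<close> stands in for the ratio \<open>N / D\<close>, which would be
  infinite where \<open>D\<close> vanishes.\<close>

lemma fraction_less:
  fixes N D N' D' :: real
  assumes "0 < N + D" "0 < N' + D'" "N' * D < N * D'"
  shows "N' / (N' + D') < N / (N + D)"
  using assms by (simp add: pos_divide_less_eq pos_less_divide_eq algebra_simps)

lemma fraction_eq_half:
  fixes N D :: real
  assumes "0 < N + D"
  shows "N / (N + D) = 1 / 2 \<longleftrightarrow> N = D"
  using assms by (auto simp: field_simps)

lemma continuous_on_slice [continuous_intros]:
  "continuous_on A f \<Longrightarrow> continuous_on A g \<Longrightarrow> continuous_on A (\<lambda>t. slice n b l (f t) (g t))"
  unfolding slice_def by (intro continuous_intros)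

lemma continuous_on_form3 [continuous_intros]:
  fixes f g h :: "_ \<Rightarrow> 'a :: real_normed_field"
  assumes "continuous_on A f" "continuous_on A g" "continuous_on A h"
  shows "continuous_on A (\<lambda>t. form3 n b (f t) (g t) (h t))"
  unfolding form3_def case_prod_unfold by (intro continuous_intros assms)

text \<open>Between \<open>t1\<close> and \<open>t2\<close> the first variable has the odd sign;
  negating all variables costs \<open>(-1) ^ n\<close> and makes \<open>form3_sign\<close>
  applicable with index \<open>n - l\<close>. Between \<open>t2\<close> and \<open>t3\<close> the
  third variable is the odd one; rotating it to the front gives index \<open>l\<close>.\<close>

lemma sign_points:
  fixes t1 t2 t3 w1 w2 w3 :: real
  assumes n: "1 \<le> n" and b: "coeffs_pos n b" "slices_log_concave n b"
    and b3: "slices_log_concave n (\<lambda>i j k. b j k i)"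
    and w: "0 < w1" "0 < w2" "0 < w3" and t: "t1 < t2" "t2 < t3"
  defines "f \<equiv> \<lambda>t. form3 n b (w1 * (t - t1)) (w2 * (t - t2)) (w3 * (t - t3))"
  obtains s where "\<And>l. l \<le> n \<Longrightarrow> 0 < (-1) ^ l * f (s l)" "\<And>l. l < n \<Longrightarrow> s (Suc l) < s l"
proof -
  define X1 where "X1 t = w1 * (t - t1)" for t
  define X2 where "X2 t = w2 * (t - t2)" for t
  define X3 where "X3 t = w3 * (t - t3)" for t
  define b' where "b' = (\<lambda>i j k. b j k i)"
  have b': "coeffs_pos n b'" "slices_log_concave n b'"
    using b(1) b3 by (auto simp: b'_def coeffs_pos_def)
  define NL where "NL l t = slice n b (n - l - 1) (- X2 t) (- X3 t)" for l t
  define DL where "DL l t = (X1 t)\<^sup>2 * slice n b (n - l + 1) (- X2 t) (- X3 t)" for l t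
  define NR where "NR l t = (X3 t)\<^sup>2 * slice n b' (l + 1) (X1 t) (X2 t)" for l t
  define DR where "DR l t = slice n b' (l - 1) (X1 t) (X2 t)" for l t
  \<comment> \<open>\<open>G l\<close> runs from 1 at \<open>t1\<close> to 0 at \<open>t3\<close>, and \<open>f\<close> has sign \<open>(-1) ^ l\<close> wherever \<open>G l\<close> equals \<open>1 / 2\<close>.
    The two fractions agree at \<open>t2\<close> because there only the monomials in the first and third
    variables survive.\<close>
  define G where "G l t = (if t \<le> t2 then NL l t / (NL l t + DL l t) else NR l t / (NR l t + DR l t))" for l t
  have left: "0 \<le> X1 t" "0 \<le> - X2 t" "0 < - X3 t" if "t1 \<le> t" "t \<le> t2" for t
    using that w t by (auto simp: X1_def X2_def X3_def mult_nonneg_nonpos mult_pos_neg)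
  have right: "0 < X1 t" "0 \<le> X2 t" "X3 t \<le> 0" if "t2 \<le> t" "t \<le> t3" for t
    using that w t by (auto simp: X1_def X2_def X3_def mult_nonneg_nonpos mult_pos_neg)
  have NL: "0 < NL l t" if "t1 \<le> t" "t \<le> t2" for l t
    unfolding NL_def using left[OF that] by (intro slice_pos[OF b(1)]) auto
  have DL: "0 \<le> DL l t" if "t1 \<le> t" "t \<le> t2" "1 \<le> l" "l < n" for l t
    unfolding DL_def using left[OF that(1,2)] that
    by (intro mult_nonneg_nonneg less_imp_le[OF slice_pos[OF b(1)]]) auto
  have DR: "0 < DR l t" if "t2 \<le> t" "t \<le> t3" "1 \<le> l" "l < n" for l t
    unfolding DR_def using right[OF that(1,2)] that by (intro slice_pos[OF b'(1)]) auto
  have NR: "0 \<le> NR l t" if "t2 \<le> t" "t \<le> t3" "1 \<le> l" "l < n" for l t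
    unfolding NR_def using right[OF that(1,2)] that
    by (intro mult_nonneg_nonneg less_imp_le[OF slice_pos[OF b'(1)]]) auto
  have glue: "NL l t2 / (NL l t2 + DL l t2) = NR l t2 / (NR l t2 + DR l t2)" if l: "1 \<le> l" "l < n" for l
  proof -
    obtain k where k: "l = Suc k" using l by (cases l) auto
    obtain m where m: "n = Suc l + m" using l by (metis less_imp_Suc_add add_Suc)
    \<comment> \<open>Both slicings reduce to the same two edge coefficients, so after cancelling
      common powers each fraction is \<open>p / (p + q)\<close>.\<close>
    define p q where "p = b m 0 (l + 1) * (X3 t2)\<^sup>2" and "q = b (m + 2) 0 (l - 1) * (X1 t2)\<^sup>2"
    have eq: "NL l t2 = p * (- X3 t2) ^ k" "DL l t2 = q * (- X3 t2) ^ k"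
      "NR l t2 = p * X1 t2 ^ m" "DR l t2 = q * X1 t2 ^ m"
      unfolding NL_def DL_def NR_def DR_def p_def q_def b'_def
      by (simp_all add: X2_def slice_zero_left slice_zero_right m k power2_eq_square)
    have "(- X3 t2) ^ k \<noteq> 0" "X1 t2 ^ m \<noteq> 0"
      using left[of t2] right[of t2] t by auto
    then show ?thesis
      unfolding eq by (simp flip: distrib_right)
  qed
  have cont: "continuous_on {t1..t3} (G l)" if l: "1 \<le> l" "l < n" for l
    unfolding G_def
  proof (rule continuous_on_cases_1)
    have "NL l t + DL l t \<noteq> 0" if "t1 \<le> t" "t \<le> t2" for t
      using NL[OF that, of l] DL[OF that l] by simp
    then show "continuous_on {t \<in> {t1..t3}. t \<le> t2} (\<lambda>t. NL l t / (NL l t + DL l t))"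
      unfolding NL_def DL_def X1_def X2_def X3_def by (intro continuous_intros) auto
    have "NR l t + DR l t \<noteq> 0" if "t2 \<le> t" "t \<le> t3" for t
      using NR[OF that l] DR[OF that l] by simp
    then show "continuous_on {t \<in> {t1..t3}. t2 \<le> t} (\<lambda>t. NR l t / (NR l t + DR l t))"
      unfolding NR_def DR_def X1_def X2_def X3_def by (intro continuous_intros) auto
  qed (use glue l in auto)
  have start: "G l t1 = 1" if "1 \<le> l" "l < n" for l
    using NL[of t1 l] t by (simp add: G_def DL_def X1_def)
  have stop: "G l t3 = 0" if "1 \<le> l" "l < n" for l
    using t by (simp add: G_def NR_def X3_def)
  have "\<exists>s. t1 < s \<and> s < t3 \<and> G l s = 1 / 2 \<and> (\<forall>t. s < t \<and> t \<le> t3 \<longrightarrow> G l t < 1 / 2)"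
    if "1 \<le> l" "l < n" for l
  proof -
    have "1 / 2 < G l t1" "G l t3 < 1 / 2" "t1 < t3"
      using start stop that t by auto
    then show ?thesis
      using last_crossing[of t1 t3 "G l" "1 / 2"] cont[OF that] by metis
  qed
  then obtain r where r: "\<And>l. 1 \<le> l \<Longrightarrow> l < n \<Longrightarrow> t1 < r l \<and> r l < t3 \<and> G l (r l) = 1 / 2"
    and after: "\<And>l t. 1 \<le> l \<Longrightarrow> l < n \<Longrightarrow> r l < t \<Longrightarrow> t \<le> t3 \<Longrightarrow> G l t < 1 / 2"
    by metis
  \<comment> \<open>Nestedness of the surfaces, from \<open>slices_log_concave_step\<close> in each
    region; it orders the crossing points.\<close>
  have mono: "G (Suc l) t < G l t" if l: "1 \<le> l" "Suc l < n" and tt: "t1 < t" "t < t3" for l t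
  proof (cases "t \<le> t2")
    case True
    have tl: "t1 \<le> t" "t \<le> t2" using True tt by auto
    have x1: "0 < X1 t" using tt w by (simp add: X1_def)
    obtain m where m: "n = Suc (Suc l) + m" using l by (metis less_imp_Suc_add add_Suc)
    have "slice n b m (- X2 t) (- X3 t) * slice n b (m + 3) (- X2 t) (- X3 t)
        < slice n b (m + 1) (- X2 t) (- X3 t) * slice n b (m + 2) (- X2 t) (- X3 t)"
      using slices_log_concave_step[OF b, of "m + 1" "- X2 t" "- X3 t"] left[OF tl] m l
      by (simp add: numeral_3_eq_3)
    then have "NL (Suc l) t * DL l t < NL l t * DL (Suc l) t"
      using x1 by (simp add: NL_def DL_def m numeral_3_eq_3 mult.left_commute)
    then show ?thesis
      using True NL[OF tl] DL[OF tl] l unfolding G_def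
      by (simp add: fraction_less add_pos_nonneg)
  next
    case False
    then have tr: "t2 \<le> t" "t \<le> t3" using tt by auto
    have x3: "X3 t \<noteq> 0" using tt w by (simp add: X3_def)
    have "slice n b' (l - 1) (X1 t) (X2 t) * slice n b' (l + 2) (X1 t) (X2 t)
        < slice n b' l (X1 t) (X2 t) * slice n b' (l + 1) (X1 t) (X2 t)"
      using slices_log_concave_step[OF b', of l "X1 t" "X2 t"] right[OF tr] l by simp
    then have "NR (Suc l) t * DR l t < NR l t * DR (Suc l) t"
      using x3 by (simp add: NR_def DR_def mult_ac)
    then show ?thesis
      using False NR[OF tr] DR[OF tr] l unfolding G_def
      by (simp add: fraction_less add_nonneg_pos)
  qed
  have sign: "0 < (-1) ^ l * f (r l)" if l: "1 \<le> l" "l < n" for l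
  proof (cases "r l \<le> t2")
    case True
    have tl: "t1 \<le> r l" "r l \<le> t2" using True r[OF l] by auto
    have x1: "0 < X1 (r l)" using r[OF l] w by (simp add: X1_def)
    have "NL l (r l) = DL l (r l)"
      using r[OF l] True NL[OF tl, of l] DL[OF tl l] unfolding G_def
      by (subst fraction_eq_half[symmetric]) auto
    then have "0 < (-1) ^ (n - l) * form3 n b (- X1 (r l)) (- X2 (r l)) (- X3 (r l))"
      using form3_sign[OF b, of "n - l" "X1 (r l)" "- X2 (r l)" "- X3 (r l)"] left[OF tl] x1 l
      by (simp add: NL_def DL_def)
    also have "form3 n b (- X1 (r l)) (- X2 (r l)) (- X3 (r l)) = (-1) ^ n * f (r l)"
      by (simp add: form3_minus f_def X1_def X2_def X3_def)
    also have "(-1) ^ (n - l) * ((-1) ^ n * f (r l)) = (-1) ^ (n - l + n) * f (r l)"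
      by (simp add: power_add)
    also have "\<dots> = (-1) ^ l * f (r l)"
      using l by (simp add: minus_one_power_iff)
    finally show ?thesis .
  next
    case False
    then have tr: "t2 \<le> r l" "r l \<le> t3" using r[OF l] by auto
    have x3: "0 < - X3 (r l)" using r[OF l] w by (simp add: X3_def mult_pos_neg)
    have "NR l (r l) = DR l (r l)"
      using r[OF l] False NR[OF tr l] DR[OF tr l] unfolding G_def
      by (subst fraction_eq_half[symmetric]) auto
    then have "0 < (-1) ^ l * form3 n b' (- (- X3 (r l))) (X1 (r l)) (X2 (r l))"
      using right[OF tr] x3 l by (intro form3_sign[OF b']) (auto simp: NR_def DR_def)
    then show ?thesis
      by (simp add: b'_def form3_rotate[of n b] f_def X1_def X2_def X3_def)
  qed
  \<comment> \<open>At \<open>t3\<close> no variable is negative and at \<open>t1\<close> none is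
    positive, which supplies the signs for \<open>l = 0\<close> and \<open>l = n\<close>.\<close>
  define s where "s l = (if l = 0 then t3 else if l = n then t1 else r l)" for l
  show thesis
  proof
    fix l assume "l \<le> n"
    then consider "l = 0" | "l = n" "0 < n" | "1 \<le> l" "l < n" by linarith
    then show "0 < (-1) ^ l * f (s l)"
    proof cases
      case 1
      have "0 < form3 n b' (X3 t3) (X1 t3) (X2 t3)"
        using right[of t3] t by (intro form3_pos[OF b'(1)]) (auto simp: X3_def)
      then show ?thesis
        using 1 by (simp add: s_def f_def b'_def form3_rotate[of n b] X1_def X2_def X3_def)
    next
      case 2
      have "0 < form3 n b (- X1 t1) (- X2 t1) (- X3 t1)"
        using left[of t1] t by (intro form3_pos[OF b(1)]) (auto simp: X1_def)
      then show ?thesis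
        using 2 unfolding form3_minus by (simp add: s_def f_def X1_def X2_def X3_def)
    next
      case 3
      then show ?thesis using sign by (simp add: s_def)
    qed
  next
    fix l assume "l < n"
    then consider "l = 0" "n = 1" | "l = 0" "1 < n" | "1 \<le> l" "Suc l = n" | "1 \<le> l" "Suc l < n" by linarith
    then show "s (Suc l) < s l"
    proof cases
      case 4
      \<comment> \<open>At \<open>r (Suc l)\<close> the value of \<open>G l\<close> exceeds 1 / 2,
        which is impossible at or after the last crossing \<open>r l\<close>.\<close>
      have "\<not> r l \<le> r (Suc l)"
      proof
        assume le: "r l \<le> r (Suc l)"
        have "G l (r (Suc l)) \<le> 1 / 2"
          using r[of l] r[of "Suc l"] after[of l "r (Suc l)"] le 4
          by (cases "r l = r (Suc l)") auto
        moreover have "G (Suc l) (r (Suc l)) < G l (r (Suc l))"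
          using mono 4 r[of "Suc l"] by auto
        ultimately show False using r[of "Suc l"] 4 by auto
      qed
      then show ?thesis using 4 by (simp add: s_def)
    qed (use t r in \<open>auto simp: s_def\<close>)
  qed
qed

section \<open>The lower bound in the upper half-plane\<close>

text \<open>Subtract from \<open>p\<close> its coefficient at \<open>n\<close> times the monic
  polynomial with root set \<open>S\<close>: a nonzero difference would have degree below
  \<open>n\<close> and yet \<open>n\<close> roots. At \<open>\<i>\<close> each factor with a real
  root has modulus at least 1.\<close>

lemma real_rooted_cmod_ge:
  fixes p :: "complex poly"
  assumes deg: "degree p \<le> n" and S: "finite S" "card S = n"
    and roots: "\<And>r. r \<in> S \<Longrightarrow> poly p (complex_of_real r) = 0"
  shows "cmod (coeff p n) \<le> cmod (poly p \<i>)"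
proof -
  define q where "q = (\<Prod>r\<in>S. [:- complex_of_real r, 1:])"
  define d where "d = p - smult (coeff p n) q"
  have degq: "degree q = n"
    unfolding q_def using S by (subst degree_prod_eq_sum_degree) auto
  have "lead_coeff q = 1"
    unfolding q_def by (simp add: lead_coeff_prod)
  then have "coeff d n = 0"
    using degq by (simp add: d_def)
  have "d = 0"
  proof (rule ccontr)
    assume "d \<noteq> 0"
    have "degree d \<le> n"
      unfolding d_def using deg degq by (intro degree_diff_le) (auto intro: order.trans[OF degree_smult_le])
    moreover have "degree d \<noteq> n"
      using \<open>d \<noteq> 0\<close> \<open>coeff d n = 0\<close> leading_coeff_0_iff by metis
    ultimately have "degree d < n" by simp
    have "poly d (complex_of_real r) = 0" if "r \<in> S" for r
      using roots[OF that] that S by (auto simp: d_def q_def poly_prod)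
    then have "card (complex_of_real ` S) \<le> card {x. poly d x = 0}"
      using \<open>d \<noteq> 0\<close> by (intro card_mono poly_roots_finite) auto
    also have "\<dots> \<le> degree d"
      using \<open>d \<noteq> 0\<close> by (rule card_poly_roots_bound)
    also have "card (complex_of_real ` S) = n"
      using S by (simp add: card_image inj_on_def)
    finally show False using \<open>degree d < n\<close> by simp
  qed
  then have "p = smult (coeff p n) q"
    by (simp add: d_def)
  then have "poly p \<i> = poly (smult (coeff p n) q) \<i>"
    by (rule arg_cong)
  also have "\<dots> = coeff p n * (\<Prod>r\<in>S. \<i> - complex_of_real r)"
    by (simp add: q_def poly_prod)
  finally have eval: "poly p \<i> = coeff p n * (\<Prod>r\<in>S. \<i> - complex_of_real r)" .
  have "1 \<le> cmod (\<i> - complex_of_real r)" for r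
    using abs_Im_le_cmod[of "\<i> - complex_of_real r"] by simp
  then have "1 \<le> cmod (\<Prod>r\<in>S. \<i> - complex_of_real r)"
    by (simp add: prod_norm[symmetric] prod_ge_1)
  then show ?thesis
    unfolding eval by (simp add: norm_mult mult_le_cancel_left1)
qed

text \<open>Each monomial becomes a product of \<open>n\<close> linear polynomials with leading
  coefficients among \<open>w1\<close>, \<open>w2\<close>, \<open>w3\<close>, so the top coefficient
  is the form at the direction of the line.\<close>

lemma form3_line_poly:
  fixes w1 w2 w3 t1 t2 t3 :: complex
  assumes w: "w1 \<noteq> 0" "w2 \<noteq> 0" "w3 \<noteq> 0"
  obtains p where "degree p \<le> n" "coeff p n = form3 n b w1 w2 w3"
    "\<And>t. poly p t = form3 n b (w1 * (t - t1)) (w2 * (t - t2)) (w3 * (t - t3))"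
proof
  define M where "M i j k = [:- w1 * t1, w1:] ^ i * [:- w2 * t2, w2:] ^ j * [:- w3 * t3, w3:] ^ k" for i j k :: nat
  define p where "p = (\<Sum>(i, j, k)\<in>triples n. smult (of_real (b i j k)) (M i j k))"
  have nz: "[:- w1 * t1, w1:] \<noteq> 0" "[:- w2 * t2, w2:] \<noteq> 0" "[:- w3 * t3, w3:] \<noteq> 0"
    using w by auto
  have deg: "degree (M i j k) = i + j + k" for i j k
    using nz w unfolding M_def by (simp add: degree_mult_eq degree_power_eq)
  have lead: "coeff (M i j k) (i + j + k) = w1 ^ i * w2 ^ j * w3 ^ k" for i j k
  proof -
    have "coeff (M i j k) (i + j + k) = lead_coeff (M i j k)" using deg by simp
    also have "\<dots> = w1 ^ i * w2 ^ j * w3 ^ k"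
      using w unfolding M_def lead_coeff_mult lead_coeff_power by simp
    finally show ?thesis .
  qed
  show "degree p \<le> n"
    unfolding p_def
    by (rule degree_sum_le, simp) (auto simp: triples_def deg intro!: order.trans[OF degree_smult_le])
  show "coeff p n = form3 n b w1 w2 w3"
    unfolding p_def form3_def coeff_sum
    by (rule sum.cong) (auto simp: triples_def lead mult.assoc)
  show "poly p t = form3 n b (w1 * (t - t1)) (w2 * (t - t2)) (w3 * (t - t3))" for t
    unfolding p_def form3_def poly_sum M_def
    by (rule sum.cong) (auto simp: mult.assoc algebra_simps)
qed

text \<open>The intermediate value theorem puts a root between consecutive points of
  \<open>sign_points\<close>, which makes \<open>n\<close> distinct real roots;
  \<open>real_rooted_cmod_ge\<close> then applies.\<close>

lemma form3_ge_ordered: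
  fixes t1 t2 t3 w1 w2 w3 :: real
  assumes n: "1 \<le> n" and b: "coeffs_pos n b" "slices_log_concave n b" "slices_log_concave n (\<lambda>i j k. b j k i)"
    and w: "0 < w1" "0 < w2" "0 < w3" and t: "t1 < t2" "t2 < t3"
  shows "form3 n b w1 w2 w3 \<le> cmod (form3 n b (w1 * (\<i> - t1)) (w2 * (\<i> - t2)) (w3 * (\<i> - t3)))"
proof -
  define f where "f t = form3 n b (w1 * (t - t1)) (w2 * (t - t2)) (w3 * (t - t3))" for t
  obtain s where s: "\<And>l. l \<le> n \<Longrightarrow> 0 < (-1) ^ l * f (s l)" "\<And>l. l < n \<Longrightarrow> s (Suc l) < s l"
    using sign_points[OF n b w t] unfolding f_def by metis
  have contf: "continuous_on A f" for A
    unfolding f_def by (intro continuous_intros)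
  have "\<exists>r. s (Suc l) < r \<and> r < s l \<and> f r = 0" if l: "l < n" for l
  proof -
    have sg: "0 < (-1) ^ l * f (s l)" "(-1) ^ l * f (s (Suc l)) < 0"
      using s(1)[of l] s(1)[of "Suc l"] l by auto
    have "continuous_on {s (Suc l)..s l} (\<lambda>t. (-1) ^ l * f t)"
      by (intro continuous_intros contf)
    then obtain r where r: "s (Suc l) \<le> r" "r \<le> s l" "(-1) ^ l * f r = 0"
      using IVT'[of "\<lambda>t. (-1) ^ l * f t" "s (Suc l)" 0 "s l"] sg s(2)[OF l] by force
    moreover have "r \<noteq> s (Suc l)" "r \<noteq> s l" using r(3) sg by auto
    ultimately show ?thesis by (intro exI[of _ r]) auto
  qed
  then obtain r where r: "\<And>l. l < n \<Longrightarrow> s (Suc l) < r l \<and> r l < s l \<and> f (r l) = 0"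
    by metis
  have s_mono: "s m \<le> s l" if "l \<le> m" "m \<le> n" for l m
    using that
  proof (induction m rule: dec_induct)
    case (step m)
    then show ?case using s(2)[of m] by simp
  qed simp
  have r_mono: "r m < r l" if "l < m" "m < n" for l m
    using r[of l] r[of m] s_mono[of "Suc l" m] that by force
  have "inj_on r {..<n}"
    by (rule linorder_inj_onI) (use r_mono in force)+
  then have card: "card (r ` {..<n}) = n" by (simp add: card_image)
  obtain p where p: "degree p \<le> n" "coeff p n = form3 n b (complex_of_real w1) w2 w3"
    "\<And>t :: complex. poly p t = form3 n b (complex_of_real w1 * (t - t1)) (w2 * (t - t2)) (w3 * (t - t3))"
    using form3_line_poly[of "complex_of_real w1" w2 w3 n b t1 t2 t3] w by auto
  have "poly p (complex_of_real t) = f t" for t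
    unfolding p(3) f_def by (simp flip: form3_of_real)
  then have "cmod (coeff p n) \<le> cmod (poly p \<i>)"
    using r card by (intro real_rooted_cmod_ge[OF p(1), of "r ` {..<n}"]) auto
  then show ?thesis
    unfolding p by (simp add: form3_of_real abs_le_iff)
qed

section \<open>Removing the order and the distinctness of the three parameters\<close>

definition log_concave_form :: "nat \<Rightarrow> (nat \<Rightarrow> nat \<Rightarrow> nat \<Rightarrow> real) \<Rightarrow> bool" where
  "log_concave_form n b \<longleftrightarrow> coeffs_pos n b \<and> slices_log_concave n b \<and>
     slices_log_concave n (\<lambda>i j k. b j k i) \<and> slices_log_concave n (\<lambda>i j k. b k i j)"

lemma slice_swap: "slice n (\<lambda>i j k. b i k j) l y z = slice n b l z y"
proof -
  define N where "N = n - l"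
  show ?thesis
    unfolding slice_def N_def[symmetric]
    by (rule sum.reindex_bij_witness[where i = "\<lambda>j. N - j" and j = "\<lambda>j. N - j"]) auto
qed

lemma slices_log_concave_swap: "slices_log_concave n b \<Longrightarrow> slices_log_concave n (\<lambda>i j k. b i k j)"
  unfolding slices_log_concave_def slice_swap[of n b] by blast

lemma log_concave_form_rotate: "log_concave_form n b \<Longrightarrow> log_concave_form n (\<lambda>i j k. b j k i)"
  by (auto simp: log_concave_form_def coeffs_pos_def)

lemma log_concave_form_swap: "log_concave_form n b \<Longrightarrow> log_concave_form n (\<lambda>i j k. b i k j)"
  using slices_log_concave_swap[of n b] slices_log_concave_swap[of n "\<lambda>i j k. b j k i"]
    slices_log_concave_swap[of n "\<lambda>i j k. b k i j"]
  by (auto simp: log_concave_form_def coeffs_pos_def)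

text \<open>A rotation puts the smallest of \<open>t1\<close>, \<open>t2\<close>, \<open>t3\<close>
  first, and a swap then orders the other two.\<close>

lemma form3_ge_distinct:
  fixes t1 t2 t3 w1 w2 w3 :: real
  assumes n: "1 \<le> n" and b: "log_concave_form n b"
    and w: "0 < w1" "0 < w2" "0 < w3" and t: "t1 \<noteq> t2" "t2 \<noteq> t3" "t1 \<noteq> t3"
  shows "form3 n b w1 w2 w3 \<le> cmod (form3 n b (w1 * (\<i> - t1)) (w2 * (\<i> - t2)) (w3 * (\<i> - t3)))"
proof -
  have first: "form3 n b w1 w2 w3 \<le> cmod (form3 n b (w1 * (\<i> - t1)) (w2 * (\<i> - t2)) (w3 * (\<i> - t3)))"
    if "log_concave_form n b" "0 < w1" "0 < w2" "0 < w3" "t1 < t2" "t1 < t3" "t2 \<noteq> t3"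
    for b and t1 t2 t3 w1 w2 w3 :: real
  proof (cases "t2 < t3")
    case True
    show ?thesis
      by (rule form3_ge_ordered) (use that n True in \<open>auto simp: log_concave_form_def\<close>)
  next
    case False
    have "form3 n (\<lambda>i j k. b i k j) w1 w3 w2
        \<le> cmod (form3 n (\<lambda>i j k. b i k j) (w1 * (\<i> - t1)) (w3 * (\<i> - t3)) (w2 * (\<i> - t2)))"
      by (rule form3_ge_ordered)
        (use that n False log_concave_form_swap[OF that(1)] in \<open>auto simp: log_concave_form_def\<close>)
    then show ?thesis unfolding form3_swap[of n b] .
  qed
  consider "t1 < t2" "t1 < t3" | "t3 < t1" "t3 < t2" | "t2 < t3" "t2 < t1"
    using t by linarith
  then show ?thesis
  proof cases
    case 1
    then show ?thesis using first b w t by blast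
  next
    case 2
    have "form3 n (\<lambda>i j k. b j k i) w3 w1 w2
        \<le> cmod (form3 n (\<lambda>i j k. b j k i) (w3 * (\<i> - t3)) (w1 * (\<i> - t1)) (w2 * (\<i> - t2)))"
      by (rule first) (use 2 w t log_concave_form_rotate[OF b] in auto)
    then show ?thesis unfolding form3_rotate[of n b] .
  next
    case 3
    have "form3 n (\<lambda>i j k. b k i j) w2 w3 w1
        \<le> cmod (form3 n (\<lambda>i j k. b k i j) (w2 * (\<i> - t2)) (w3 * (\<i> - t3)) (w1 * (\<i> - t1)))"
      by (rule first) (use 3 w t log_concave_form_rotate[OF log_concave_form_rotate[OF b]] in auto)
    then show ?thesis
      unfolding form3_rotate[of n "\<lambda>i j k. b j k i"] form3_rotate[of n b] .
  qed
qed

lemma form3_ge: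
  fixes t1 t2 t3 w1 w2 w3 :: real
  assumes n: "1 \<le> n" and b: "log_concave_form n b" and w: "0 < w1" "0 < w2" "0 < w3"
  shows "form3 n b w1 w2 w3 \<le> cmod (form3 n b (w1 * (\<i> - t1)) (w2 * (\<i> - t2)) (w3 * (\<i> - t3)))"
proof -
  \<comment> \<open>Shifts by 0, \<open>e\<close> and \<open>2 * e\<close> separate coinciding
    parameters: only three values of \<open>e\<close> produce a tie. The bound then passes to the
    limit.\<close>
  define h where "h e = cmod (form3 n b (w1 * (\<i> - t1)) (w2 * (\<i> - complex_of_real (t2 + e)))
    (w3 * (\<i> - complex_of_real (t3 + 2 * e))))" for e
  have "continuous_on UNIV h"
    unfolding h_def by (intro continuous_intros)
  then have "isCont h 0"
    by (simp add: continuous_on_eq_continuous_at)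
  then have "(h \<longlongrightarrow> h 0) (at 0)" by (simp add: isCont_def)
  moreover have "eventually (\<lambda>e. form3 n b w1 w2 w3 \<le> h e) (at 0)"
  proof -
    have "eventually (\<lambda>e. e \<noteq> t1 - t2 \<and> e \<noteq> t2 - t3 \<and> e \<noteq> (t1 - t3) / 2) (at (0::real))"
      by (intro eventually_conj eventually_neq_at_within)
    then show ?thesis
    proof eventually_elim
      case (elim e)
      show ?case unfolding h_def
        by (rule form3_ge_distinct) (use elim n b w in auto)
    qed
  qed
  ultimately have "form3 n b w1 w2 w3 \<le> h 0"
    by (rule tendsto_lowerbound) simp
  then show ?thesis by (simp add: h_def)
qed

section \<open>From rhombus inequalities to the half-plane property\<close>

text \<open>One of the three orientations of rhombi, with denominators cleared; the left side holds
  the ends of the long diagonal. Rotating \<open>b\<close> gives the other two orientations.\<close>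

definition rhombic :: "nat \<Rightarrow> real \<Rightarrow> (nat \<Rightarrow> nat \<Rightarrow> nat \<Rightarrow> real) \<Rightarrow> bool" where
  "rhombic n q b \<longleftrightarrow> (\<forall>i j k. i + j + k + 2 = n \<longrightarrow>
     q * (b (i + 2) j k * b i (j + 1) (k + 1)) \<le> b (i + 1) (j + 1) k * b (i + 1) j (k + 1))"

text \<open>The three orientations supply \<open>middle\<close>, \<open>left\<close> and
  \<open>right\<close> for the rows \<open>l - 1\<close>, \<open>l\<close>, \<open>l + 1\<close>. If
  \<open>n = 2\<close>, only \<open>l = 1\<close> occurs, hence \<open>m = 1\<close>.\<close>

lemma rhombic_imp_slices_log_concave:
  assumes pos: "coeffs_pos n b"
    and rh: "rhombic n q b" "rhombic n q (\<lambda>i j k. b j k i)" "rhombic n q (\<lambda>i j k. b k i j)"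
    and large: "4 \<le> q \<or> n = 2 \<and> 2 < q"
  shows "slices_log_concave n b"
  unfolding slices_log_concave_def
proof (intro allI impI, elim conjE)
  fix l and y z :: real
  assume l: "1 \<le> l" "l < n" and yz: "0 \<le> y" "0 \<le> z" "0 < y \<or> 0 < z"
  define m where "m = n - l"
  obtain p where p: "l = Suc p" using l by (cases l) auto
  have n: "n = Suc p + m" using l p by (simp add: m_def)
  interpret rhombus_rows m q "\<lambda>j. b l j (m - j)" "\<lambda>j. b p j (Suc m - j)" "\<lambda>j. b (Suc l) j (m - 1 - j)"
  proof
    fix j assume "j < m"
    then obtain k where k: "m = Suc (j + k)" by (metis less_imp_Suc_add)
    show "q * (b p (Suc j) (Suc m - Suc j) * b (Suc l) j (m - 1 - j)) \<le> b l j (m - j) * b l (Suc j) (m - Suc j)"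
      using rh(1)[unfolded rhombic_def, rule_format, of p j k] by (simp add: n p k mult.commute Suc_diff_le)
    show "q * (b p j (Suc m - j) * b l (Suc j) (m - Suc j)) \<le> b l j (m - j) * b p (Suc j) (Suc m - Suc j)"
      using rh(2)[unfolded rhombic_def, rule_format, of k p j] by (simp add: n p k mult.commute Suc_diff_le)
    show "q * (b p (Suc (Suc j)) (Suc m - Suc (Suc j)) * b l j (m - j)) \<le> b l (Suc j) (m - Suc j) * b p (Suc j) (Suc m - Suc j)"
      using rh(3)[unfolded rhombic_def, rule_format, of j k p] by (simp add: n p k mult.commute Suc_diff_le)
  qed (use l large pos n p in \<open>auto simp: coeffs_pos_def\<close>)
  have large': "4 \<le> q \<or> m = 1 \<and> 2 < q"
    using large l n p by auto
  show "4 * (slice n b (l - 1) y z * slice n b (l + 1) y z) < (slice n b l y z)\<^sup>2"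
    using rows_log_concave[OF yz large'] by (simp add: slice_def n p)
qed

lemma rhombic_imp_log_concave_form:
  assumes "coeffs_pos n b"
    and "rhombic n q b" "rhombic n q (\<lambda>i j k. b j k i)" "rhombic n q (\<lambda>i j k. b k i j)"
    and "4 \<le> q \<or> n = 2 \<and> 2 < q"
  shows "log_concave_form n b"
  unfolding log_concave_form_def
  using assms rhombic_imp_slices_log_concave[of n b q]
    rhombic_imp_slices_log_concave[of n "\<lambda>i j k. b j k i" q]
    rhombic_imp_slices_log_concave[of n "\<lambda>i j k. b k i j" q]
  by (auto simp: coeffs_pos_def)

text \<open>
  For quadratic forms the quotient bound \<open>2\<close> gives log-concavity only with equality allowed;
  shrinking the coefficients of the squares makes it strict.
\<close>

lemma form3_quadratic_ge:
  fixes t1 t2 t3 w1 w2 w3 :: real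
  assumes pos: "coeffs_pos 2 b"
    and rh: "rhombic 2 2 b" "rhombic 2 2 (\<lambda>i j k. b j k i)" "rhombic 2 2 (\<lambda>i j k. b k i j)"
    and w: "0 < w1" "0 < w2" "0 < w3"
  shows "form3 2 b w1 w2 w3 \<le> cmod (form3 2 b (w1 * (\<i> - t1)) (w2 * (\<i> - t2)) (w3 * (\<i> - t3)))"
proof -
  define B where "B e i j k = (if 2 \<in> {i, j, k} then (1 - e) * b i j k else b i j k)" for e :: real and i j k :: nat
  define h where "h e = cmod (form3 2 (B e) (w1 * (\<i> - t1)) (w2 * (\<i> - t2)) (w3 * (\<i> - t3)))
    - form3 2 (B e) w1 w2 w3" for e
  have "isCont (\<lambda>e. B e i j k) 0" for i j k
    unfolding B_def by (cases "2 \<in> {i, j, k}") (auto intro!: continuous_intros)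
  then have "isCont h 0"
    unfolding h_def form3_def case_prod_unfold by (intro continuous_intros)
  then have "(h \<longlongrightarrow> h 0) (at_right 0)"
    unfolding isCont_def by (rule filterlim_at_split[THEN iffD1, THEN conjunct2])
  moreover have "eventually (\<lambda>e. 0 \<le> h e) (at_right 0)"
  proof -
    have "eventually (\<lambda>e. 0 < e \<and> e < 1) (at_right (0::real))"
      by (rule eventually_at_rightI[of 0 1]) auto
    then show ?thesis
    proof eventually_elim
      case (elim e)
      have "coeffs_pos 2 (B e)"
        using pos elim by (auto simp: coeffs_pos_def B_def)
      \<comment> \<open>In degree 2 each rhombus has exactly one square among its four coefficients,
        at an end of the long diagonal, so the quotient bound grows from 2 to
        \<open>2 / (1 - e)\<close>.\<close>
      moreover have "rhombic 2 (2 / (1 - e)) (B e)" "rhombic 2 (2 / (1 - e)) (\<lambda>i j k. B e j k i)"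
        "rhombic 2 (2 / (1 - e)) (\<lambda>i j k. B e k i j)"
        using rh elim by (auto simp: rhombic_def B_def)
      moreover have "2 < 2 / (1 - e)"
        using elim by (simp add: field_simps)
      ultimately have "log_concave_form 2 (B e)"
        by (intro rhombic_imp_log_concave_form) auto
      then show ?case
        using form3_ge[of 2 "B e" w1 w2 w3 t1 t2 t3] w by (simp add: h_def)
    qed
  qed
  ultimately have "0 \<le> h 0"
    by (rule tendsto_lowerbound) simp
  moreover have "B 0 = b" by (simp add: B_def fun_eq_iff)
  ultimately show ?thesis by (simp add: h_def)
qed

section \<open>Translation from coefficients indexed by vectors, and the theorem\<close>

lemma ternary_form_eq_form3:
  "ternary_form n a v = form3 n (\<lambda>i j k. a (vector [i, j, k])) (v $ 1) (v $ 2) (v $ 3)"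
proof -
  have "vector [\<alpha> $ 1, \<alpha> $ 2, \<alpha> $ 3] = \<alpha>" for \<alpha> :: "nat ^ 3"
    by (simp add: vec_eq_iff forall_3)
  then show ?thesis
    unfolding ternary_form_def form3_def
    by (intro sum.reindex_bij_witness[where i = "\<lambda>(i, j, k). vector [i, j, k]"
          and j = "\<lambda>\<alpha>. (\<alpha> $ 1, \<alpha> $ 2, \<alpha> $ 3)"])
      (auto simp: tri_grid_def triples_def)
qed

lemma rhombus_quotients_imp_rhombic:
  fixes a :: "nat ^ 3 \<Rightarrow> real"
  assumes pos: "\<And>\<alpha>. \<alpha> \<in> tri_grid n \<Longrightarrow> a \<alpha> > 0"
    and quot: "\<And>r. r \<in> rhombus_quotients n a \<Longrightarrow> q \<le> r"
  defines "b \<equiv> \<lambda>i j k. a (vector [i, j, k])"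
  shows "rhombic n q b" "rhombic n q (\<lambda>i j k. b j k i)" "rhombic n q (\<lambda>i j k. b k i j)"
proof -
  have rh: "q * (a \<alpha> * a \<delta>) \<le> a \<beta> * a \<gamma>" if "(\<alpha>, \<beta>, \<gamma>, \<delta>) \<in> rhombi n" for \<alpha> \<beta> \<gamma> \<delta>
  proof -
    have "q \<le> a \<beta> * a \<gamma> / (a \<alpha> * a \<delta>)"
      using that by (intro quot) (auto simp: rhombus_quotients_def)
    moreover have "0 < a \<alpha> * a \<delta>"
      using that by (intro mult_pos_pos pos) (auto simp: rhombi_def)
    ultimately show ?thesis by (simp add: pos_le_divide_eq)
  qed
  have rhombiI: "(\<alpha>, \<beta>, \<gamma>, \<delta>) \<in> rhombi n"
    if "\<alpha> \<in> tri_grid n" "\<beta> \<in> tri_grid n" "\<gamma> \<in> tri_grid n" "\<delta> \<in> tri_grid n"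
      "{i, j, k} = {1, 2, 3}" "\<mu> $ 1 + \<mu> $ 2 + \<mu> $ 3 = int n - 1"
      "int_vec \<alpha> = \<mu> + axis k 1" "int_vec \<beta> = \<mu> + axis i 1" "int_vec \<gamma> = \<mu> + axis j 1"
      "int_vec \<delta> = \<mu> + axis i 1 + axis j 1 - axis k 1"
    for \<alpha> \<beta> \<gamma> \<delta> \<mu> i j k
    using that unfolding rhombi_def by blast
  note rhombus_simps = tri_grid_def int_vec_def vec_eq_iff forall_3 axis_def
  show "rhombic n q b"
    unfolding rhombic_def b_def
  proof (intro allI impI rh)
    fix i j k assume "i + j + k + 2 = n"
    then show "(vector [i + 2, j, k], vector [i + 1, j + 1, k], vector [i + 1, j, k + 1],
        vector [i, j + 1, k + 1]) \<in> rhombi n"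
      \<comment> \<open>\<open>\<mu>\<close> is the first vertex lowered by one in the coordinate
        that carries the 2.\<close>
      by (intro rhombiI[where \<mu> = "vector [int i + 1, int j, int k]" and i = 2 and j = 3 and k = 1])
        (auto simp: rhombus_simps)
  qed
  show "rhombic n q (\<lambda>i j k. b j k i)"
    unfolding rhombic_def b_def
  proof (intro allI impI rh)
    fix i j k assume "i + j + k + 2 = n"
    then show "(vector [j, k, i + 2], vector [j + 1, k, i + 1], vector [j, k + 1, i + 1],
        vector [j + 1, k + 1, i]) \<in> rhombi n"
      by (intro rhombiI[where \<mu> = "vector [int j, int k, int i + 1]" and i = 1 and j = 2 and k = 3])
        (auto simp: rhombus_simps)
  qed
  show "rhombic n q (\<lambda>i j k. b k i j)"
    unfolding rhombic_def b_def
  proof (intro allI impI rh)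
    fix i j k assume "i + j + k + 2 = n"
    then show "(vector [k, i + 2, j], vector [k, i + 1, j + 1], vector [k + 1, i + 1, j],
        vector [k + 1, i, j + 1]) \<in> rhombi n"
      by (intro rhombiI[where \<mu> = "vector [int k, int i + 1, int j]" and i = 3 and j = 1 and k = 2])
        (auto simp: rhombus_simps)
  qed
qed

theorem theorem4p3:
  fixes n :: nat and a :: "nat ^ 3 \<Rightarrow> real"
  assumes "n \<ge> 2"
    and "\<And>\<alpha>. \<alpha> \<in> tri_grid n \<Longrightarrow> a \<alpha> > 0"
    and "\<And>q. q \<in> rhombus_quotients n a \<Longrightarrow> q \<ge> 2 * (real n - 1)"
  shows "half_plane_property (ternary_form n a)"
proof -
  define b where "b = (\<lambda>i j k. a (vector [i, j, k]))"
  have pos: "coeffs_pos n b"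
    using assms(2) by (simp add: coeffs_pos_def b_def tri_grid_def)
  have rh: "rhombic n (2 * (real n - 1)) b" "rhombic n (2 * (real n - 1)) (\<lambda>i j k. b j k i)"
    "rhombic n (2 * (real n - 1)) (\<lambda>i j k. b k i j)"
    using rhombus_quotients_imp_rhombic[of n a "2 * (real n - 1)"] assms(2,3) unfolding b_def by blast+
  \<comment> \<open>The constant \<open>2 * (n - 1)\<close> is 2 in the borderline case
    \<open>n = 2\<close> and at least 4 from \<open>n = 3\<close> on.\<close>
  have ge: "form3 n b w1 w2 w3 \<le> cmod (form3 n b (w1 * (\<i> - t1)) (w2 * (\<i> - t2)) (w3 * (\<i> - t3)))"
    if "0 < w1" "0 < w2" "0 < w3" for w1 w2 w3 t1 t2 t3 :: real
  proof (cases "n = 2")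
    case True
    then show ?thesis
      using form3_quadratic_ge[of b] pos rh that by simp
  next
    case False
    then have "log_concave_form n b"
      using assms(1) by (intro rhombic_imp_log_concave_form[OF pos rh]) auto
    then show ?thesis
      using form3_ge that assms(1) by simp
  qed
  \<comment> \<open>The half-plane is the upper one, as \<open>\<i> \<bullet> z\<close> is the
    imaginary part of \<open>z\<close>. Its points have the form \<open>w * (\<i> - t)\<close> with
    \<open>w\<close> the imaginary part and \<open>t = - Re / Im\<close>.\<close>
  have "ternary_form n a v \<noteq> 0" if v: "\<forall>i. 0 < \<i> \<bullet> v $ i" for v
  proof -
    have im: "0 < Im (v $ i)" for i using v by (simp add: inner_complex_def)
    have "v $ i = of_real (Im (v $ i)) * (\<i> - of_real (- Re (v $ i) / Im (v $ i)))" for i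
      using im[of i] by (simp add: complex_eq_iff)
    then have "form3 n b (Im (v $ 1)) (Im (v $ 2)) (Im (v $ 3)) \<le> cmod (form3 n b (v $ 1) (v $ 2) (v $ 3))"
      using ge[OF im im im, of 1 2 3 "- Re (v $ 1) / Im (v $ 1)" "- Re (v $ 2) / Im (v $ 2)" "- Re (v $ 3) / Im (v $ 3)"]
      by metis
    moreover have "0 < form3 n b (Im (v $ 1)) (Im (v $ 2)) (Im (v $ 3))"
      using im by (intro form3_pos[OF pos]) (auto simp: less_imp_le)
    ultimately show ?thesis
      unfolding ternary_form_eq_form3 b_def by force
  qed
  then show ?thesis
    unfolding half_plane_property_def by (intro exI[of _ "{z. \<i> \<bullet> z > 0}"] exI[of _ \<i>]) auto
qed

end
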